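(* For $n\ge 1$ let $A_1(n)=\sum_{m=1}^n \log(m+1)\,e_m\left(1,\tfrac12,\ldots,\tfrac1n\right)$ and, for $r\ge 2$, let $\tilde A_r(n)=\frac{1}{r!}\sum_{l=0}^{n-1}\log(l+r+1)\, m_{[r,1^l]}\left(1,\tfrac12,\ldots,\tfrac1n\right)$. Then the limits $$\rho_1:=\lim_{n\to\infty}\frac{A_1(n)}{n\log\log n},\qquad \tilde\rho_r:=\lim_{n\to\infty}\frac{\tilde A_r(n)}{n\log\log n}\quad (r\ge 2 \text{ fixed})$$ exist, $\rho_1=1$, and for every $r\ge 2$, $$\tilde\rho_r=\frac{1}{r!}\left[(-1)^r+\sum_{j=3}^r(-1)^{r+j}\zeta(j-1)\right],$$ where the sum is empty when $r=2$.
   Context: $e_m(x_1,\ldots,x_n)$ is the $m$-th elementary symmetric polynomial. For integers $r\ge 2$, $l\ge 0$, $[r,1^l]$ denotes the partition with one part equal to $r$ and $l$ parts equal to $1$, and $m_{[r,1^l]}(x_1,\ldots,x_n)$ is the associated monomial symmetric polynomial, i.e. the sum of all distinct monomials obtained from $x_1^r x_2\cdots x_{l+1}$ by permuting the variables. $\zeta$ is the Riemann zeta function. *)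

theory Defs
  imports Complex_Main "HOL-Combinatorics.Permutations"
begin

text \<open>
  Symmetric polynomials are represented by their values at a point
  \<open>x 1, \<dots>, x n\<close> (only the values \<open>x i\<close> with \<open>1 \<le> i \<le> n\<close> are used).
\<close>

definition elem_sym :: "nat \<Rightarrow> nat \<Rightarrow> (nat \<Rightarrow> 'a::comm_semiring_1) \<Rightarrow> 'a" where
  "elem_sym m n x = (\<Sum>S | S \<subseteq> {1..n} \<and> card S = m. \<Prod>i\<in>S. x i)"

text \<open>
  \<open>part_exponent \<lambda> i\<close> is the exponent of the \<open>i\<close>-th variable (counted from 1) in the
  monomial \<open>x 1 ^ (\<lambda> ! 0) * x 2 ^ (\<lambda> ! 1) * \<dots>\<close>.
\<close>

definition part_exponent :: "nat list \<Rightarrow> nat \<Rightarrow> nat" where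
  "part_exponent lam i = (if 1 \<le> i \<and> i \<le> length lam then lam ! (i - 1) else 0)"

text \<open>
  The index set below is a set of exponent vectors, so each distinct monomial is counted once,
  however many permutations produce it. In fewer variables than \<open>\<lambda>\<close> has parts, the
  polynomial is 0.
\<close>

definition monomial_sym :: "nat list \<Rightarrow> nat \<Rightarrow> (nat \<Rightarrow> 'a::comm_semiring_1) \<Rightarrow> 'a" where
  "monomial_sym lam n x =
     (if length lam \<le> n
      then \<Sum>a \<in> {part_exponent lam \<circ> p | p. p permutes {1..n}}. \<Prod>i=1..n. x i ^ a i
      else 0)"

definition hook_part :: "nat \<Rightarrow> nat \<Rightarrow> nat list" where
  "hook_part r l = r # replicate l 1"

text \<open>The Riemann zeta function on the real half-line \<open>s > 1\<close>, the only range needed.\<close>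

definition zeta :: "real \<Rightarrow> real" where
  "zeta s = (\<Sum>k. 1 / real (Suc k) powr s)"

definition A_one :: "nat \<Rightarrow> real" where
  "A_one n = (\<Sum>m=1..n. ln (real (m + 1)) * elem_sym m n (\<lambda>i. 1 / real i))"

definition A_tilde :: "nat \<Rightarrow> nat \<Rightarrow> real" where
  "A_tilde r n =
     1 / fact r * (\<Sum>l=0..n-1. ln (real (l + r + 1)) *
                       monomial_sym (hook_part r l) n (\<lambda>i. 1 / real i))"

end

theory Submission
  imports Defs "HOL-Analysis.Harmonic_Numbers" "HOL-Real_Asymp.Real_Asymp"
begin

text \<open>
  Choose a random subset \<open>S\<close> of a finite set \<open>I\<close> with weight \<open>\<Prod>i\<in>S. x i\<close>. The total weight is
  \<open>\<Prod>i\<in>I. 1 + x i\<close>, the element \<open>i\<close> is included with probability \<open>x i / (1 + x i)\<close>, and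
  \<open>card S\<close> has mean \<open>\<mu> = \<Sum>i\<in>I. x i / (1 + x i)\<close>. Jensen gives
  \<open>E ln (card S + c) \<le> ln (\<mu> + c)\<close>, while \<open>E (1 / (card S + 1)) \<le> 1 / \<mu>\<close> and
  \<open>ln y \<ge> ln \<mu> + 1 - \<mu> / y\<close> give \<open>E ln (card S + c) \<ge> ln \<mu>\<close>. For \<open>x i = 1 / i\<close> on \<open>{1..n}\<close>
  the total weight telescopes to \<open>n + 1\<close> and \<open>\<mu>\<close> is \<open>ln n\<close> up to a bounded error, also after
  one index is removed. The hook polynomial is the sum over \<open>i\<close> of \<open>x i ^ r\<close> times the
  elementary symmetric polynomial in the other variables, so the limit is
  \<open>1 / fact r\<close> times \<open>\<Sum>\<^sub>i 1 / (i^(r-1) (i+1))\<close>.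
\<close>

section \<open>Weighted sums over the subsets of a finite set\<close>

lemma sum_Pow_by_card:
  fixes f :: "'a set \<Rightarrow> 'b::comm_semiring_0"
  assumes "finite I" "card I \<le> n"
  shows "(\<Sum>m=0..n. g m * (\<Sum>S | S \<subseteq> I \<and> card S = m. f S)) = (\<Sum>S\<in>Pow I. g (card S) * f S)"
proof -
  have "(\<Sum>m=0..n. \<Sum>S\<in>{S\<in>Pow I. card S = m}. g (card S) * f S) = (\<Sum>S\<in>Pow I. g (card S) * f S)"
    using assms by (intro sum.group) (auto intro: order_trans[OF card_mono])
  moreover have "g m * (\<Sum>S | S \<subseteq> I \<and> card S = m. f S) =
      (\<Sum>S\<in>{S\<in>Pow I. card S = m}. g (card S) * f S)" for m
    by (auto simp: sum_distrib_left intro!: sum.cong)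
  ultimately show ?thesis by simp
qed

lemma sum_Pow_prod:
  fixes x :: "'a \<Rightarrow> 'b::comm_semiring_1"
  assumes "finite I"
  shows "(\<Sum>S\<in>Pow I. prod x S) = (\<Prod>i\<in>I. 1 + x i)"
  using prod_add[OF assms, of x "\<lambda>_. 1"] by (simp add: add.commute)

lemma sum_Pow_split:
  fixes f :: "'a set \<Rightarrow> 'b::comm_monoid_add"
  assumes "finite I" "i \<in> I"
  shows "(\<Sum>S\<in>Pow I. f S) = (\<Sum>T\<in>Pow (I - {i}). f T) + (\<Sum>T\<in>Pow (I - {i}). f (insert i T))"
proof -
  have "Pow I = Pow (I - {i}) \<union> insert i ` Pow (I - {i})"
    using Pow_insert[of i "I - {i}"] assms(2) by (simp add: insert_absorb)
  moreover have "inj_on (insert i) (Pow (I - {i}))"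
    by (auto simp: inj_on_def)
  moreover have "Pow (I - {i}) \<inter> insert i ` Pow (I - {i}) = {}"
    by auto
  ultimately show ?thesis
    using assms(1) by (simp add: sum.union_disjoint sum.reindex)
qed

text \<open>Double counting: write \<open>card S\<close> as the number of \<open>i\<close> in
  \<open>S\<close>, swap the two sums and put \<open>S = insert i T\<close>. Constant
  \<open>f\<close> gives the mean of \<open>card S\<close>, and \<open>f k = 1 / k\<close> gives the
  reciprocal moment.\<close>

lemma sum_Pow_size_bias:
  fixes x :: "'a \<Rightarrow> real"
  assumes "finite I"
  shows "(\<Sum>S\<in>Pow I. real (card S) * f (card S) * prod x S) =
    (\<Sum>i\<in>I. x i * (\<Sum>T\<in>Pow (I - {i}). f (Suc (card T)) * prod x T))"
proof -
  have "(\<Sum>S\<in>Pow I. real (card S) * f (card S) * prod x S) =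
      (\<Sum>S\<in>Pow I. \<Sum>i\<in>I. if i \<in> S then f (card S) * prod x S else 0)"
  proof (rule sum.cong)
    fix S assume "S \<in> Pow I"
    then have "I \<inter> S = S" by auto
    then have "(\<Sum>i\<in>I. if i \<in> S then f (card S) * prod x S else 0) = (\<Sum>i\<in>S. f (card S) * prod x S)"
      using assms by (simp add: sum.inter_restrict[symmetric])
    then show "real (card S) * f (card S) * prod x S =
        (\<Sum>i\<in>I. if i \<in> S then f (card S) * prod x S else 0)"
      by simp
  qed simp
  also have "\<dots> = (\<Sum>i\<in>I. \<Sum>S\<in>Pow I. if i \<in> S then f (card S) * prod x S else 0)"
    by (rule sum.swap)
  also have "\<dots> = (\<Sum>i\<in>I. x i * (\<Sum>T\<in>Pow (I - {i}). f (Suc (card T)) * prod x T))"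
  proof (rule sum.cong)
    fix i assume i: "i \<in> I"
    have "(\<Sum>S\<in>Pow I. if i \<in> S then f (card S) * prod x S else 0) =
        (\<Sum>T\<in>Pow (I - {i}). f (card (insert i T)) * prod x (insert i T))"
      by (subst sum_Pow_split[OF assms i]) (auto intro!: sum.neutral)
    also have "\<dots> = (\<Sum>T\<in>Pow (I - {i}). x i * (f (Suc (card T)) * prod x T))"
    proof (rule sum.cong)
      fix T assume "T \<in> Pow (I - {i})"
      then have "finite T" "i \<notin> T" using assms by (auto intro: finite_subset)
      then show "f (card (insert i T)) * prod x (insert i T) = x i * (f (Suc (card T)) * prod x T)"
        by simp
    qed simp
    finally show "(\<Sum>S\<in>Pow I. if i \<in> S then f (card S) * prod x S else 0) =
        x i * (\<Sum>T\<in>Pow (I - {i}). f (Suc (card T)) * prod x T)"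
      by (simp add: sum_distrib_left)
  qed simp
  finally show ?thesis .
qed

lemma prod_remove_factor:
  fixes x :: "'a \<Rightarrow> real"
  assumes "finite I" "i \<in> I" "x i \<ge> 0"
  shows "(\<Prod>j\<in>I - {i}. 1 + x j) = (\<Prod>j\<in>I. 1 + x j) / (1 + x i)"
  using prod.remove[OF assms(1,2), of "\<lambda>j. 1 + x j"] assms(3) by simp

lemma sum_Pow_card:
  fixes x :: "'a \<Rightarrow> real"
  assumes "finite I" "\<And>i. i \<in> I \<Longrightarrow> x i \<ge> 0"
  shows "(\<Sum>S\<in>Pow I. real (card S) * prod x S) = (\<Sum>i\<in>I. x i / (1 + x i)) * (\<Prod>i\<in>I. 1 + x i)"
proof -
  have "(\<Sum>S\<in>Pow I. real (card S) * prod x S) = (\<Sum>i\<in>I. x i * (\<Prod>j\<in>I - {i}. 1 + x j))"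
    using sum_Pow_size_bias[OF assms(1), of "\<lambda>_. 1" x] assms(1) by (simp add: sum_Pow_prod)
  also have "\<dots> = (\<Sum>i\<in>I. x i / (1 + x i) * (\<Prod>i\<in>I. 1 + x i))"
    using assms by (intro sum.cong) (auto simp: prod_remove_factor)
  finally show ?thesis by (simp add: sum_distrib_right)
qed

text \<open>
  Size biasing with \<open>w = prod x\<close>: \<open>\<Sum> w S\<close> over nonempty \<open>S\<close> equals
  \<open>\<Sum>\<^sub>i x i * (\<Sum> w T / (card T + 1))\<close> with \<open>T\<close> avoiding \<open>i\<close>, and forbidding \<open>i\<close> costs at
  most a factor \<open>1 + x i\<close>.
\<close>

lemma sum_Pow_inverse_card_le:
  fixes x :: "'a \<Rightarrow> real"
  assumes "finite I" and x: "\<And>i. i \<in> I \<Longrightarrow> x i \<ge> 0"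
  shows "(\<Sum>i\<in>I. x i / (1 + x i)) * (\<Sum>S\<in>Pow I. prod x S / (real (card S) + 1))
      \<le> (\<Prod>i\<in>I. 1 + x i)"
proof -
  let ?R = "\<lambda>I. \<Sum>S\<in>Pow I. prod x S / (real (card S) + 1)"
  have avoid: "?R I / (1 + x i) \<le> ?R (I - {i})" if i: "i \<in> I" for i
  proof -
    have "?R I = ?R (I - {i}) + (\<Sum>T\<in>Pow (I - {i}). prod x (insert i T) / (real (card (insert i T)) + 1))"
      by (rule sum_Pow_split[OF assms(1) i])
    also have "(\<Sum>T\<in>Pow (I - {i}). prod x (insert i T) / (real (card (insert i T)) + 1))
        \<le> (\<Sum>T\<in>Pow (I - {i}). x i * (prod x T / (real (card T) + 1)))"
    proof (rule sum_mono)
      fix T assume T: "T \<in> Pow (I - {i})"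
      then have "finite T" "i \<notin> T" using assms by (auto intro: finite_subset)
      moreover have "prod x T \<ge> 0" using T x by (intro prod_nonneg) auto
      \<comment> \<open>Inserting \<open>i\<close> contributes the factor \<open>x i\<close> and
        only enlarges the denominator.\<close>
      ultimately show "prod x (insert i T) / (real (card (insert i T)) + 1)
          \<le> x i * (prod x T / (real (card T) + 1))"
        using x[OF i] by (auto intro!: divide_left_mono mult_nonneg_nonneg)
    qed
    also have "\<dots> = x i * ?R (I - {i})"
      by (simp add: sum_distrib_left)
    finally show ?thesis
      using x[OF i] by (simp add: field_simps)
  qed
  have "(\<Sum>i\<in>I. x i / (1 + x i)) * ?R I = (\<Sum>i\<in>I. x i * (?R I / (1 + x i)))"
    by (simp add: sum_distrib_right)
  also have "\<dots> \<le> (\<Sum>i\<in>I. x i * ?R (I - {i}))"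
    using x avoid by (intro sum_mono mult_left_mono) auto
  also have "\<dots> = (\<Sum>S\<in>Pow I. real (card S) * (1 / real (card S)) * prod x S)"
    using sum_Pow_size_bias[OF assms(1), of "\<lambda>k. 1 / real k" x] by (simp add: add.commute)
  \<comment> \<open>The factor \<open>card S * (1 / card S)\<close> is 1 for nonempty
    \<open>S\<close> and 0 for the empty set, where \<open>1 / 0 = 0\<close>.\<close>
  also have "\<dots> \<le> (\<Sum>S\<in>Pow I. prod x S)"
    using x by (intro sum_mono mult_left_le_one_le prod_nonneg) auto
  also have "\<dots> = (\<Prod>i\<in>I. 1 + x i)"
    by (rule sum_Pow_prod[OF assms(1)])
  finally show ?thesis .
qed

lemma sum_Pow_ln_card_le:
  fixes x :: "'a \<Rightarrow> real"
  assumes "finite I" and x: "\<And>i. i \<in> I \<Longrightarrow> x i \<ge> 0" and "c > 0"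
  shows "(\<Sum>S\<in>Pow I. ln (real (card S) + c) * prod x S)
      \<le> (\<Prod>i\<in>I. 1 + x i) * ln ((\<Sum>i\<in>I. x i / (1 + x i)) + c)"
proof -
  define a where "a = (\<Sum>i\<in>I. x i / (1 + x i)) + c"
  have "(\<Sum>i\<in>I. x i / (1 + x i)) \<ge> 0" using x by (intro sum_nonneg) auto
  then have a: "a > 0" using assms(3) by (simp add: a_def)
  \<comment> \<open>The concave function \<open>ln\<close> lies below its tangent at
    \<open>a\<close>, the mean of \<open>card S + c\<close>.\<close>
  have tangent: "ln (real k + c) \<le> (ln a - 1 + c / a) + real k / a" for k
  proof -
    have "real k + c > 0" using assms(3) by linarith
    then have "ln ((real k + c) / a) \<le> (real k + c) / a - 1"
      using a by (intro ln_le_minus_one divide_pos_pos)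
    moreover have "ln ((real k + c) / a) = ln (real k + c) - ln a"
      using a \<open>real k + c > 0\<close> by (simp add: ln_div)
    ultimately show ?thesis by (simp add: add_divide_distrib)
  qed
  have "(\<Sum>S\<in>Pow I. ln (real (card S) + c) * prod x S)
      \<le> (\<Sum>S\<in>Pow I. ((ln a - 1 + c / a) + real (card S) / a) * prod x S)"
    using x tangent by (intro sum_mono mult_right_mono prod_nonneg) auto
  also have "\<dots> = (ln a - 1 + c / a) * (\<Sum>S\<in>Pow I. prod x S) + (\<Sum>S\<in>Pow I. real (card S) * prod x S) / a"
    by (simp only: distrib_right sum.distrib sum_distrib_left sum_divide_distrib times_divide_eq_left)
  \<comment> \<open>The mean of \<open>card S\<close> is \<open>a - c\<close>, so everything except
    \<open>ln a\<close> cancels.\<close>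
  also have "\<dots> = (\<Prod>i\<in>I. 1 + x i) * ((ln a - 1 + c / a) + (a - c) / a)"
    using sum_Pow_card[OF assms(1), of x] x
    by (simp add: sum_Pow_prod[OF assms(1)] a_def distrib_left mult.commute)
  also have "\<dots> = (\<Prod>i\<in>I. 1 + x i) * ln a"
    using a by (simp add: diff_divide_distrib)
  finally show ?thesis by (simp add: a_def)
qed

lemma sum_Pow_ln_card_ge:
  fixes x :: "'a \<Rightarrow> real"
  assumes "finite I" and x: "\<And>i. i \<in> I \<Longrightarrow> x i \<ge> 0" and "c \<ge> 1"
    and a: "(\<Sum>i\<in>I. x i / (1 + x i)) > 0"
  shows "(\<Prod>i\<in>I. 1 + x i) * ln (\<Sum>i\<in>I. x i / (1 + x i))
      \<le> (\<Sum>S\<in>Pow I. ln (real (card S) + c) * prod x S)"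
proof -
  define a where "a = (\<Sum>i\<in>I. x i / (1 + x i))"
  have a: "a > 0" using assms(4) by (simp add: a_def)
  \<comment> \<open>Lowering \<open>c\<close> to 1 produces exactly the reciprocal
    \<open>1 / (card S + 1)\<close> whose weighted sum is bounded above.\<close>
  have tangent: "ln (real k + c) \<ge> (ln a + 1) - a * (1 / (real k + 1))" for k
  proof -
    have "ln (a / (real k + 1)) \<le> a / (real k + 1) - 1"
      using a by (intro ln_le_minus_one divide_pos_pos) auto
    moreover have "ln (a / (real k + 1)) = ln a - ln (real k + 1)"
      using a by (simp add: ln_div)
    moreover have "ln (real k + 1) \<le> ln (real k + c)"
      using assms(3) by simp
    ultimately show ?thesis by simp
  qed
  have "(\<Prod>i\<in>I. 1 + x i) * ln a \<le> (ln a + 1) * (\<Prod>i\<in>I. 1 + x i) -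
      a * (\<Sum>S\<in>Pow I. prod x S / (real (card S) + 1))"
    using sum_Pow_inverse_card_le[OF assms(1) x] by (simp add: a_def algebra_simps)
  also have "\<dots> = (\<Sum>S\<in>Pow I. ((ln a + 1) - a * (1 / (real (card S) + 1))) * prod x S)"
    using assms(1)
    by (simp add: sum_Pow_prod[symmetric] left_diff_distrib sum_subtractf sum_distrib_left)
  also have "\<dots> \<le> (\<Sum>S\<in>Pow I. ln (real (card S) + c) * prod x S)"
    using x tangent by (intro sum_mono mult_right_mono prod_nonneg) auto
  finally show ?thesis by (simp add: a_def)
qed

section \<open>Hook monomials indexed by a marked variable and a subset\<close>

text \<open>For \<open>i\<close> outside \<open>T\<close> this is the exponent vector of
  \<open>x i ^ r * prod x T\<close>.\<close>

definition hook_exponent :: "nat \<Rightarrow> nat \<Rightarrow> nat set \<Rightarrow> nat \<Rightarrow> nat" where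
  "hook_exponent r i T j = (if j = i then r else if j \<in> T then 1 else 0)"

lemma part_exponent_hook_part:
  "part_exponent (hook_part r l) = hook_exponent r 1 {2..Suc l}"
proof
  fix j :: nat
  consider "j = 0" | "j = 1" | k where "j = Suc (Suc k)"
    by (metis One_nat_def not0_implies_Suc)
  then show "part_exponent (hook_part r l) j = hook_exponent r 1 {2..Suc l} j"
    by cases (auto simp: part_exponent_def hook_part_def hook_exponent_def)
qed

text \<open>Transitivity of the permutations on pairs \<open>(i, T)\<close>: glue the map from
  \<open>i\<close> to 1, a bijection from \<open>T\<close> onto \<open>{2..Suc l}\<close> and one
  between the remaining indices, whose numbers agree.\<close>

lemma obtain_permutation_hook:
  assumes i: "i \<in> {1..n}" and T: "T \<subseteq> {1..n} - {i}" "card T = l"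
  obtains p where "p permutes {1..n}" "p i = 1" "p ` T = {2..Suc l}"
proof -
  have fin: "finite T" using T(1) finite_subset by blast
  have "card T \<le> card ({1..n} - {i})" by (rule card_mono) (use T in auto)
  then have l: "Suc l \<le> n" using i T(2) by auto
  obtain f where f: "bij_betw f T {2..Suc l}"
    using finite_same_card_bij[OF fin, of "{2..Suc l}"] T(2) by auto
  have "card ({1..n} - insert i T) = card {Suc (Suc l)..n}"
    using i T fin l by (subst card_Diff_subset) (auto simp: card_insert_if)
  then obtain g where g: "bij_betw g ({1..n} - insert i T) {Suc (Suc l)..n}"
    using finite_same_card_bij[of "{1..n} - insert i T" "{Suc (Suc l)..n}"] by auto
  define p where "p j = (if j = i then 1 else if j \<in> T then f j else if j \<in> {1..n} then g j else j)" for j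
  have p1: "bij_betw p {i} {1}" by (simp add: p_def bij_betw_def)
  have pT: "bij_betw p T {2..Suc l}"
    using f T(1) by (subst bij_betw_cong[of _ _ f]) (auto simp: p_def)
  have pg: "bij_betw p ({1..n} - insert i T) {Suc (Suc l)..n}"
    using g by (subst bij_betw_cong[of _ _ g]) (auto simp: p_def)
  have "bij_betw p ({i} \<union> T) ({1} \<union> {2..Suc l})"
    by (rule bij_betw_combine[OF p1 pT]) auto
  then have "bij_betw p (({i} \<union> T) \<union> ({1..n} - insert i T)) (({1} \<union> {2..Suc l}) \<union> {Suc (Suc l)..n})"
    by (rule bij_betw_combine[OF _ pg]) auto
  moreover have "({i} \<union> T) \<union> ({1..n} - insert i T) = {1..n}" using i T by auto
  moreover have "({1} \<union> {2..Suc l}) \<union> {Suc (Suc l)..n} = {1..n}" using l by auto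
  ultimately have "bij_betw p {1..n} {1..n}" by simp
  then have "p permutes {1..n}"
    by (rule bij_imp_permutes) (use i T in \<open>auto simp: p_def\<close>)
  moreover have "p i = 1" by (simp add: p_def)
  moreover have "p ` T = {2..Suc l}" using pT by (simp add: bij_betw_def)
  ultimately show ?thesis using that by blast
qed

lemma hook_exponent_permutations:
  assumes "Suc l \<le> n"
  shows "{part_exponent (hook_part r l) \<circ> p | p. p permutes {1..n}} =
    (\<lambda>(i, T). hook_exponent r i T) ` (SIGMA i:{1..n}. {T. T \<subseteq> {1..n} - {i} \<and> card T = l})"
    (is "?L = ?R")
proof (intro equalityI subsetI)
  fix a assume "a \<in> ?L"
  then obtain p where p: "p permutes {1..n}" and a: "a = hook_exponent r 1 {2..Suc l} \<circ> p"
    by (auto simp: part_exponent_hook_part)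
  \<comment> \<open>The vector composed with \<open>p\<close> has its entry \<open>r\<close> where
    \<open>p\<close> takes the value 1, and its ones where \<open>p\<close> lands in
    \<open>{2..Suc l}\<close>; the pair is therefore an image under \<open>inv p\<close>.\<close>
  let ?q = "inv p"
  have q: "?q permutes {1..n}" using p by (rule permutes_inv)
  have "?q ` {2..Suc l} \<subseteq> ?q ` ({1..n} - {1})"
    using assms by (intro image_mono) auto
  also have "\<dots> = {1..n} - {?q 1}"
    using permutes_image[OF q] permutes_inj[OF q] by (simp add: image_set_diff)
  finally have "?q ` {2..Suc l} \<subseteq> {1..n} - {?q 1}" .
  moreover have "card (?q ` {2..Suc l}) = l"
    using permutes_inj[OF q] by (simp add: card_image inj_on_subset)
  moreover have "?q 1 \<in> {1..n}"
    using assms permutes_in_image[OF q, of 1] by simp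
  moreover have "a = hook_exponent r (?q 1) (?q ` {2..Suc l})"
  proof
    fix j
    have "p j = 1 \<longleftrightarrow> j = ?q 1" using permutes_inv_eq[OF p] by metis
    moreover have "p j \<in> {2..Suc l} \<longleftrightarrow> j \<in> ?q ` {2..Suc l}"
      using permutes_inv_eq[OF p] unfolding image_iff by metis
    ultimately show "a j = hook_exponent r (?q 1) (?q ` {2..Suc l}) j"
      by (simp add: a hook_exponent_def)
  qed
  ultimately show "a \<in> ?R" by auto
next
  fix a assume "a \<in> ?R"
  then obtain i T where i: "i \<in> {1..n}" and T: "T \<subseteq> {1..n} - {i}" "card T = l"
    and a: "a = hook_exponent r i T" by auto
  obtain p where p: "p permutes {1..n}" "p i = 1" "p ` T = {2..Suc l}"
    using obtain_permutation_hook[OF i T] .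
  have "a = hook_exponent r 1 {2..Suc l} \<circ> p"
  proof
    fix j
    have "p j = 1 \<longleftrightarrow> j = i" using permutes_inj[OF p(1)] p(2) by (metis injD)
    moreover have "p j \<in> {2..Suc l} \<longleftrightarrow> j \<in> T"
      using permutes_inj[OF p(1)] p(3) by (metis inj_image_mem_iff)
    ultimately show "a j = (hook_exponent r 1 {2..Suc l} \<circ> p) j"
      by (simp add: a hook_exponent_def)
  qed
  then show "a \<in> ?L" using p(1) by (auto simp: part_exponent_hook_part)
qed

text \<open>Since \<open>r\<close> differs from 0 and 1, the vector reveals \<open>i\<close> as the
  position of the entry \<open>r\<close> and \<open>T\<close> as the positions of the entry
  1.\<close>

lemma inj_on_hook_exponent:
  assumes "r \<ge> 2"
  shows "inj_on (\<lambda>(i, T). hook_exponent r i T) (SIGMA i:A. {T. T \<subseteq> B - {i} \<and> P T})"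
proof (rule inj_onI, clarify)
  fix i T i' T'
  assume T: "T \<subseteq> B - {i}" "T' \<subseteq> B - {i'}" and eq: "hook_exponent r i T = hook_exponent r i' T'"
  have "j = i \<longleftrightarrow> j = i'" "j \<noteq> i \<and> j \<in> T \<longleftrightarrow> j \<noteq> i' \<and> j \<in> T'" for j
    using fun_cong[OF eq, of j] assms by (auto simp: hook_exponent_def split: if_splits)
  then show "i = i' \<and> T = T'" using T by blast
qed

lemma monomial_sym_hook_part:
  fixes x :: "nat \<Rightarrow> 'a::comm_semiring_1"
  assumes "r \<ge> 2" "Suc l \<le> n"
  shows "monomial_sym (hook_part r l) n x =
    (\<Sum>i=1..n. x i ^ r * (\<Sum>T | T \<subseteq> {1..n} - {i} \<and> card T = l. prod x T))"
proof -
  let ?D = "SIGMA i:{1..n}. {T. T \<subseteq> {1..n} - {i} \<and> card T = l}"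
  have "monomial_sym (hook_part r l) n x =
      (\<Sum>a\<in>(\<lambda>(i, T). hook_exponent r i T) ` ?D. \<Prod>j=1..n. x j ^ a j)"
    using hook_exponent_permutations[OF assms(2), of r] assms(2)
    by (simp add: monomial_sym_def hook_part_def)
  \<comment> \<open>By injectivity, distinct monomials correspond to distinct pairs, so none is
    counted twice.\<close>
  also have "\<dots> = (\<Sum>(i, T)\<in>?D. \<Prod>j=1..n. x j ^ hook_exponent r i T j)"
    by (subst sum.reindex[OF inj_on_hook_exponent[OF assms(1)]]) (simp add: o_def case_prod_unfold)
  also have "\<dots> = (\<Sum>(i, T)\<in>?D. x i ^ r * prod x T)"
  proof (intro sum.cong refl, clarify)
    fix i T assume i: "i \<in> {1..n}" and T: "T \<subseteq> {1..n} - {i}"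
    have "(\<Prod>j=1..n. x j ^ hook_exponent r i T j) =
        x i ^ hook_exponent r i T i * (\<Prod>j\<in>{1..n} - {i}. x j ^ hook_exponent r i T j)"
      using i by (intro prod.remove) auto
    also have "(\<Prod>j\<in>{1..n} - {i}. x j ^ hook_exponent r i T j) = prod x T"
      using T by (intro prod.mono_neutral_cong_right) (auto simp: hook_exponent_def)
    finally show "(\<Prod>j=1..n. x j ^ hook_exponent r i T j) = x i ^ r * prod x T"
      by (simp add: hook_exponent_def)
  qed
  also have "\<dots> = (\<Sum>i=1..n. \<Sum>T | T \<subseteq> {1..n} - {i} \<and> card T = l. x i ^ r * prod x T)"
    by (subst sum.Sigma) auto
  finally show ?thesis by (simp add: sum_distrib_left)
qed

section \<open>Both quantities as logarithmic sums over subsets\<close>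

lemma A_one_eq:
  "A_one n = (\<Sum>S\<in>Pow {1..n}. ln (real (card S) + 1) * (\<Prod>i\<in>S. 1 / real i))"
proof -
  \<comment> \<open>The term \<open>m = 0\<close> may be added because
    \<open>ln 1 = 0\<close>.\<close>
  have "A_one n = (\<Sum>m=0..n. ln (real m + 1) * (\<Sum>S | S \<subseteq> {1..n} \<and> card S = m. \<Prod>i\<in>S. 1 / real i))"
    unfolding A_one_def elem_sym_def
    by (intro sum.mono_neutral_cong_left) (auto simp: add.commute Suc_le_eq)
  then show ?thesis using sum_Pow_by_card[of "{1..n}" n "\<lambda>m. ln (real m + 1)"] by simp
qed

lemma A_tilde_eq:
  assumes "r \<ge> 2" "n \<ge> 1"
  shows "A_tilde r n = 1 / fact r * (\<Sum>i=1..n. 1 / real i ^ r *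
    (\<Sum>T\<in>Pow ({1..n} - {i}). ln (real (card T) + (real r + 1)) * (\<Prod>j\<in>T. 1 / real j)))"
proof -
  let ?e = "\<lambda>i l. \<Sum>T | T \<subseteq> {1..n} - {i} \<and> card T = l. \<Prod>j\<in>T. 1 / real j"
  have "(\<Sum>l=0..n-1. ln (real (l + r + 1)) * monomial_sym (hook_part r l) n (\<lambda>i. 1 / real i)) =
      (\<Sum>l=0..n-1. \<Sum>i=1..n. 1 / real i ^ r * (ln (real l + (real r + 1)) * ?e i l))"
  proof (rule sum.cong)
    fix l assume "l \<in> {0..n-1}"
    then have "Suc l \<le> n" using assms(2) by auto
    then show "ln (real (l + r + 1)) * monomial_sym (hook_part r l) n (\<lambda>i. 1 / real i) =
        (\<Sum>i=1..n. 1 / real i ^ r * (ln (real l + (real r + 1)) * ?e i l))"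
      using assms(1)
      by (simp add: monomial_sym_hook_part sum_distrib_left power_one_over add_ac mult_ac)
  qed simp
  also have "\<dots> = (\<Sum>i=1..n. 1 / real i ^ r * (\<Sum>l=0..n-1. ln (real l + (real r + 1)) * ?e i l))"
    by (subst sum.swap) (simp only: sum_distrib_left)
  \<comment> \<open>The range of \<open>l\<close> ends at \<open>n - 1\<close>, the size of
    \<open>{1..n} - {i}\<close>, so every subset is reached.\<close>
  also have "\<dots> = (\<Sum>i=1..n. 1 / real i ^ r *
    (\<Sum>T\<in>Pow ({1..n} - {i}). ln (real (card T) + (real r + 1)) * (\<Prod>j\<in>T. 1 / real j)))"
    by (intro sum.cong refl arg_cong2[where f = "(*)"]) (subst sum_Pow_by_card, auto)
  finally show ?thesis by (simp only: A_tilde_def)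
qed

section \<open>Explicit bounds at the point \<open>x i = 1 / i\<close>\<close>

lemma prod_one_plus_inverse: "(\<Prod>i=1..n. 1 + 1 / real i) = real n + 1"
  by (induction n) (auto simp: field_simps)

lemma inclusion_prob_inverse: "i \<ge> 1 \<Longrightarrow> (1 / real i) / (1 + 1 / real i) = 1 / (real i + 1)"
  by (simp add: field_simps)

lemma sum_inclusion_prob_bounds:
  shows "ln (real n + 1) - 1 \<le> (\<Sum>i=1..n. (1 / real i) / (1 + 1 / real i))"
    and "n \<ge> 1 \<Longrightarrow> (\<Sum>i=1..n. (1 / real i) / (1 + 1 / real i)) \<le> ln (real n) + 1"
proof -
  have "(\<Sum>i=1..n. (1 / real i) / (1 + 1 / real i)) = (\<Sum>i=1..n. 1 / (real i + 1))"
    by (intro sum.cong) (auto simp: inclusion_prob_inverse simp del: divide_divide_eq_left)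
  also have "\<dots> = harm n - 1 + 1 / (real n + 1)"
    by (induction n) (auto simp: harm_Suc harm_expand divide_inverse add_ac)
  finally have eq: "(\<Sum>i=1..n. (1 / real i) / (1 + 1 / real i)) = harm n - 1 + 1 / (real n + 1)" .
  show "ln (real n + 1) - 1 \<le> (\<Sum>i=1..n. (1 / real i) / (1 + 1 / real i))"
    unfolding eq using ln_le_harm[of n] by (simp add: add.commute add_increasing2)
  show "(\<Sum>i=1..n. (1 / real i) / (1 + 1 / real i)) \<le> ln (real n) + 1" if "n \<ge> 1"
  proof -
    \<comment> \<open>The sequence \<open>harm n - ln n\<close> decreases from its value 1 at
      \<open>n = 1\<close>.\<close>
    have "harm n \<le> ln (real n) + 1"
      using euler_mascheroni_sequence_decreasing[of 1 n] that by (simp add: harm_expand)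
    moreover have "1 / (real n + 1) \<le> 1" by simp
    ultimately show ?thesis unfolding eq by linarith
  qed
qed

lemma A_one_bounds:
  assumes "ln (real n + 1) > 1" "n \<ge> 1"
  shows "(real n + 1) * ln (ln (real n + 1) - 1) \<le> A_one n"
    and "A_one n \<le> (real n + 1) * ln (ln (real n) + 2)"
proof -
  let ?m = "\<Sum>i=1..n. (1 / real i) / (1 + 1 / real i)"
  have m: "ln (real n + 1) - 1 \<le> ?m" "?m \<le> ln (real n) + 1"
    using sum_inclusion_prob_bounds assms by auto
  have "(real n + 1) * ln (ln (real n + 1) - 1) \<le> (real n + 1) * ln ?m"
    using m assms by (intro mult_left_mono ln_mono) auto
  also have "\<dots> \<le> A_one n"
    using sum_Pow_ln_card_ge[of "{1..n}" "\<lambda>i. 1 / real i" 1] m assms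
    by (simp only: A_one_eq prod_one_plus_inverse) simp
  finally show "(real n + 1) * ln (ln (real n + 1) - 1) \<le> A_one n" .
  have "A_one n \<le> (real n + 1) * ln (?m + 1)"
    using sum_Pow_ln_card_le[of "{1..n}" "\<lambda>i. 1 / real i" 1]
    by (simp only: A_one_eq prod_one_plus_inverse) simp
  also have "\<dots> \<le> (real n + 1) * ln (ln (real n) + 2)"
    using m assms by (intro mult_left_mono ln_mono) auto
  finally show "A_one n \<le> (real n + 1) * ln (ln (real n) + 2)" .
qed

text \<open>Removing \<open>i\<close> divides the total weight \<open>n + 1\<close> by
  \<open>1 + 1 / i\<close>. Together with \<open>1 / i ^ r\<close> this yields the summand of
  \<open>C\<close> times \<open>n + 1\<close>, while the logarithmic factors are bounded uniformly
  in \<open>i\<close>.\<close>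

lemma A_tilde_bounds:
  assumes "ln (real n + 1) > 2" "n \<ge> 1" "r \<ge> 2"
  defines "C \<equiv> (\<Sum>i=1..n. 1 / (real i ^ (r - 1) * (real i + 1)))"
  shows "1 / fact r * (C * ((real n + 1) * ln (ln (real n + 1) - 2))) \<le> A_tilde r n"
    and "A_tilde r n \<le> 1 / fact r * (C * ((real n + 1) * ln (ln (real n) + real r + 2)))"
proof -
  let ?x = "\<lambda>i. 1 / real i"
  let ?m = "\<lambda>I. \<Sum>i\<in>I. (1 / real i) / (1 + 1 / real i)"
  let ?G = "\<lambda>i. \<Sum>T\<in>Pow ({1..n} - {i}). ln (real (card T) + (real r + 1)) * (\<Prod>j\<in>T. 1 / real j)"
  have weight: "1 / real i ^ r * ((real n + 1) / (1 + 1 / real i)) =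
      1 / (real i ^ (r - 1) * (real i + 1)) * (real n + 1)" if "i \<in> {1..n}" for i
    using that assms(3) by (cases r) (auto simp: divide_simps)
  have W: "(\<Prod>j\<in>{1..n} - {i}. 1 + 1 / real j) = (real n + 1) / (1 + 1 / real i)" if "i \<in> {1..n}" for i
    using prod_remove_factor[of "{1..n}" i ?x] that by (simp only: prod_one_plus_inverse) simp
  \<comment> \<open>Removing \<open>i\<close> lowers the mean by \<open>1 / (i + 1)\<close>, which
    lies between 0 and 1; hence 2 replaces 1 in the lower bound, and the upper bound is
    unchanged.\<close>
  have m: "ln (real n + 1) - 2 \<le> ?m ({1..n} - {i})" "?m ({1..n} - {i}) \<le> ln (real n) + 1"
    if "i \<in> {1..n}" for i
  proof -
    have "?m {1..n} = 1 / (real i + 1) + ?m ({1..n} - {i})"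
      using that by (subst sum.remove[of _ i]) (auto simp: inclusion_prob_inverse simp del: divide_divide_eq_left)
    moreover have "0 \<le> 1 / (real i + 1)" "1 / (real i + 1) \<le> 1" by auto
    ultimately show "ln (real n + 1) - 2 \<le> ?m ({1..n} - {i})" "?m ({1..n} - {i}) \<le> ln (real n) + 1"
      using sum_inclusion_prob_bounds(1)[of n] sum_inclusion_prob_bounds(2)[OF assms(2)] by linarith+
  qed
  have lower: "1 / (real i ^ (r - 1) * (real i + 1)) * ((real n + 1) * ln (ln (real n + 1) - 2))
      \<le> 1 / real i ^ r * ?G i" if i: "i \<in> {1..n}" for i
  proof -
    have "1 / (real i ^ (r - 1) * (real i + 1)) * ((real n + 1) * ln (ln (real n + 1) - 2)) =
        1 / real i ^ r * ((real n + 1) / (1 + 1 / real i) * ln (ln (real n + 1) - 2))"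
      using weight[OF i] by (simp only: mult.assoc[symmetric])
    also have "\<dots> \<le> 1 / real i ^ r * ((real n + 1) / (1 + 1 / real i) * ln (?m ({1..n} - {i})))"
      using m(1)[OF i] assms(1) by (intro mult_left_mono ln_mono) auto
    also have "\<dots> \<le> 1 / real i ^ r * ?G i"
      using sum_Pow_ln_card_ge[of "{1..n} - {i}" ?x "real r + 1"] m(1)[OF i] assms(1)
      by (intro mult_left_mono) (simp_all only: W[OF i], simp_all)
    finally show ?thesis .
  qed
  have upper: "1 / real i ^ r * ?G i
      \<le> 1 / (real i ^ (r - 1) * (real i + 1)) * ((real n + 1) * ln (ln (real n) + real r + 2))"
    if i: "i \<in> {1..n}" for i
  proof -
    have "1 / real i ^ r * ?G i
        \<le> 1 / real i ^ r * ((real n + 1) / (1 + 1 / real i) * ln (?m ({1..n} - {i}) + (real r + 1)))"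
      using sum_Pow_ln_card_le[of "{1..n} - {i}" ?x "real r + 1"]
      by (intro mult_left_mono) (simp_all only: W[OF i], simp_all)
    \<comment> \<open>The mean is at most \<open>ln n + 1\<close>, and the shift adds
      \<open>r + 1\<close>.\<close>
    also have "\<dots> \<le> 1 / real i ^ r * ((real n + 1) / (1 + 1 / real i) * ln (ln (real n) + real r + 2))"
      using m[OF i] assms(1) by (intro mult_left_mono ln_mono) auto
    also have "\<dots> = 1 / (real i ^ (r - 1) * (real i + 1)) * ((real n + 1) * ln (ln (real n) + real r + 2))"
      using weight[OF i] by (simp only: mult.assoc[symmetric])
    finally show ?thesis .
  qed
  show "1 / fact r * (C * ((real n + 1) * ln (ln (real n + 1) - 2))) \<le> A_tilde r n"
    unfolding A_tilde_eq[OF assms(3,2)] C_def sum_distrib_right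
    using lower by (intro mult_left_mono sum_mono) auto
  show "A_tilde r n \<le> 1 / fact r * (C * ((real n + 1) * ln (ln (real n) + real r + 2)))"
    unfolding A_tilde_eq[OF assms(3,2)] C_def sum_distrib_right
    using upper by (intro mult_left_mono sum_mono) auto
qed

section \<open>The limiting constant as a zeta combination\<close>

lemma zeta_sums:
  assumes "k \<ge> 2"
  shows "(\<lambda>i. 1 / real (Suc i) ^ k) sums zeta (real k)"
proof -
  have "summable (\<lambda>i. inverse (real i ^ k))"
    using inverse_power_summable[OF assms, where ?'a = real] by simp
  then have "summable (\<lambda>i. 1 / real (Suc i) ^ k)"
    by (subst (asm) summable_Suc_iff[symmetric]) (simp add: divide_inverse)
  moreover have "zeta (real k) = (\<Sum>i. 1 / real (Suc i) ^ k)"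
    unfolding zeta_def by (simp add: powr_realpow)
  ultimately show ?thesis by (simp add: summable_sums)
qed

text \<open>Induction on \<open>r\<close> through \<open>1 / (i^r (i+1)) = 1 / i^r - 1 / (i^(r-1) (i+1))\<close>.\<close>

lemma hook_weight_sums:
  "(\<lambda>i. 1 / (real (Suc i) ^ Suc k * (real (Suc i) + 1))) sums
    ((-1) ^ (k + 2) + (\<Sum>j=3..k + 2. (-1) ^ (k + 2 + j) * zeta (real (j - 1))))"
proof (induction k)
  case 0
  \<comment> \<open>Here \<open>r = k + 2 = 2\<close>: the zeta sum is empty, and the series of
    \<open>1 / (i * (i + 1))\<close> telescopes to 1.\<close>
  have "(\<lambda>i. 1 / real (Suc i)) \<longlonglongrightarrow> 0" by real_asymp
  from telescope_sums'[OF this] show ?case by (simp add: divide_simps)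
next
  case (Suc k)
  have "1 / real (Suc i) ^ (k + 2) - 1 / (real (Suc i) ^ Suc k * (real (Suc i) + 1)) =
      1 / (real (Suc i) ^ Suc (Suc k) * (real (Suc i) + 1))" for i
    by (simp add: divide_simps del: of_nat_Suc)
  \<comment> \<open>Subtraction flips every old sign. The new index \<open>j = k + 3\<close> has
    even sign exponent \<open>2 * k + 6\<close> and so contributes \<open>zeta (k + 2)\<close>
    positively.\<close>
  moreover have "zeta (real (k + 2)) -
      ((-1) ^ (k + 2) + (\<Sum>j=3..k + 2. (-1) ^ (k + 2 + j) * zeta (real (j - 1)))) =
      (-1) ^ (Suc k + 2) + (\<Sum>j=3..Suc k + 2. (-1) ^ (Suc k + 2 + j) * zeta (real (j - 1)))"
  proof -
    have "{3..Suc k + 2} = insert (k + 3) {3..k + 2}" by auto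
    moreover have "(-1 :: real) ^ (Suc k + 2 + (k + 3)) = 1" by (rule minus_one_power_iff[THEN trans]) simp
    ultimately show ?thesis by (simp add: sum_negf)
  qed
  ultimately show ?case
    using sums_diff[OF zeta_sums[of "k + 2"] Suc.IH] by (simp only: le_add2)
qed

lemma hook_weight_LIMSEQ:
  assumes "r \<ge> 2"
  shows "(\<lambda>n. \<Sum>i=1..n. 1 / (real i ^ (r - 1) * (real i + 1))) \<longlonglongrightarrow>
    (-1) ^ r + (\<Sum>j=3..r. (-1) ^ (r + j) * zeta (real (j - 1)))"
proof -
  obtain k where k: "r = k + 2" using assms by (metis le_add_diff_inverse2)
  have "(\<Sum>i=1..n. 1 / (real i ^ (r - 1) * (real i + 1))) =
      (\<Sum>i<n. 1 / (real (Suc i) ^ Suc k * (real (Suc i) + 1)))" for n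
    using sum.atLeast1_atMost_eq[of "\<lambda>i. 1 / (real i ^ (r - 1) * (real i + 1))" n] by (simp add: k)
  then show ?thesis using hook_weight_sums[of k] by (simp add: sums_def k)
qed

section \<open>Passage to the limit by squeezing\<close>

lemma A_one_LIMSEQ: "(\<lambda>n. A_one n / (real n * ln (ln (real n)))) \<longlonglongrightarrow> 1"
proof (rule tendsto_sandwich)
  have ev: "\<forall>\<^sub>F n in sequentially. n \<ge> 1 \<and> ln (real n + 1) > 1 \<and> real n * ln (ln (real n)) > 0"
    by (intro eventually_conj eventually_ge_at_top; real_asymp)
  show "\<forall>\<^sub>F n in sequentially. (real n + 1) * ln (ln (real n + 1) - 1) / (real n * ln (ln (real n)))
      \<le> A_one n / (real n * ln (ln (real n)))"
    using ev by eventually_elim (intro divide_right_mono A_one_bounds, auto)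
  show "\<forall>\<^sub>F n in sequentially. A_one n / (real n * ln (ln (real n))) \<le>
      (real n + 1) * ln (ln (real n) + 2) / (real n * ln (ln (real n)))"
    using ev by eventually_elim (intro divide_right_mono A_one_bounds, auto)
  \<comment> \<open>Bounded shifts of \<open>ln n\<close> do not affect the leading order of
    \<open>ln (ln n)\<close>, so both bounds are asymptotic to \<open>n * ln (ln n)\<close>.\<close>
  show "(\<lambda>n. (real n + 1) * ln (ln (real n + 1) - 1) / (real n * ln (ln (real n)))) \<longlonglongrightarrow> 1"
    by real_asymp
  show "(\<lambda>n. (real n + 1) * ln (ln (real n) + 2) / (real n * ln (ln (real n)))) \<longlonglongrightarrow> 1"
    by real_asymp
qed

lemma A_tilde_LIMSEQ:
  assumes "r \<ge> 2"
  shows "(\<lambda>n. A_tilde r n / (real n * ln (ln (real n)))) \<longlonglongrightarrow>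
      1 / fact r * ((-1) ^ r + (\<Sum>j=3..r. (-1) ^ (r + j) * zeta (real (j - 1))))" (is "_ \<longlonglongrightarrow> ?L")
proof (rule tendsto_sandwich)
  let ?C = "\<lambda>n. \<Sum>i=1..n. 1 / (real i ^ (r - 1) * (real i + 1))"
  have ev: "\<forall>\<^sub>F n in sequentially. n \<ge> 1 \<and> ln (real n + 1) > 2 \<and> real n * ln (ln (real n)) > 0"
    by (intro eventually_conj eventually_ge_at_top; real_asymp)
  show "\<forall>\<^sub>F n in sequentially.
      1 / fact r * (?C n * ((real n + 1) * ln (ln (real n + 1) - 2))) / (real n * ln (ln (real n)))
      \<le> A_tilde r n / (real n * ln (ln (real n)))"
    using ev by eventually_elim (intro divide_right_mono A_tilde_bounds, use assms in auto)
  show "\<forall>\<^sub>F n in sequentially. A_tilde r n / (real n * ln (ln (real n))) \<le>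
      1 / fact r * (?C n * ((real n + 1) * ln (ln (real n) + real r + 2))) / (real n * ln (ln (real n)))"
    using ev by eventually_elim (intro divide_right_mono A_tilde_bounds, use assms in auto)
  \<comment> \<open>The partial sums \<open>?C n\<close> converge to the zeta combination, so only
    the growth of the remaining factor \<open>g\<close> has to be compared with
    \<open>n * ln (ln n)\<close>.\<close>
  have scale: "(\<lambda>n. 1 / fact r * (?C n * g n) / (real n * ln (ln (real n)))) \<longlonglongrightarrow> ?L"
    if "(\<lambda>n. g n / (real n * ln (ln (real n)))) \<longlonglongrightarrow> 1" for g :: "nat \<Rightarrow> real"
    using tendsto_mult[OF tendsto_const tendsto_mult[OF hook_weight_LIMSEQ[OF assms] that], of "1 / fact r"]
    by simp
  show "(\<lambda>n. 1 / fact r * (?C n * ((real n + 1) * ln (ln (real n + 1) - 2))) /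
      (real n * ln (ln (real n)))) \<longlonglongrightarrow> ?L"
    by (rule scale) real_asymp
  show "(\<lambda>n. 1 / fact r * (?C n * ((real n + 1) * ln (ln (real n) + real r + 2))) /
      (real n * ln (ln (real n)))) \<longlonglongrightarrow> ?L"
    by (rule scale) real_asymp
qed

theorem theorem7:
  "((\<lambda>n. A_one n / (real n * ln (ln (real n)))) \<longlonglongrightarrow> 1) \<and>
   (\<forall>r\<ge>2. (\<lambda>n. A_tilde r n / (real n * ln (ln (real n)))) \<longlonglongrightarrow>
      1 / fact r * ((-1) ^ r + (\<Sum>j=3..r. (-1) ^ (r + j) * zeta (real (j - 1)))))"
  using A_one_LIMSEQ A_tilde_LIMSEQ by blast

end
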